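(* Let $(X,\unlhd,\wedge,\vee,0,1)$ be a bounded trellis and $T^*$ a t-norm on $X$. If every pseudo-t-norm $T$ on $X$ is $T^*$-distributive, then $T^*=\wedge$. Moreover, $(X,\unlhd,\wedge,\vee)$ is a lattice.
   Context: A pseudo-order $\unlhd$ on a set $X$ is a reflexive and antisymmetric relation (not necessarily transitive); lower/upper bounds, infima and suprema are defined as for partially ordered sets (they are unique when they exist). A trellis $(X,\unlhd,\wedge,\vee)$ is a set with a pseudo-order in which any two elements $x,y$ have an infimum $x\wedge y$ and a supremum $x\vee y$. It is a lattice if in addition $\unlhd$ is transitive. It is bounded, written $(X,\unlhd,\wedge,\vee,0,1)$, if it has elements $0,1$ with $0\unlhd x\unlhd 1$ for all $x\in X$. An element $\alpha\in X$ is right-transitive if $\alpha\unlhd x\unlhd y$ implies $\alpha\unlhd y$; left-transitive if $x\unlhd y\unlhd\alpha$ implies $x\unlhd\alpha$; middle-transitive if $x\unlhd\alpha\unlhd y$ implies $x\unlhd y$ (for all $x,y\in X$); transitive if all three hold. A triple $(x,y,z)$ is $\wedge$-associative if $(x\wedge y)\wedge z=x\wedge(y\wedge z)$, and $\vee$-associative if $(x\vee y)\vee z=x\vee(y\vee z)$. An element is $\wedge$-associative (resp. $\vee$-associative) if every triple in $X^3$ containing it is $\wedge$-associative (resp. $\vee$-associative). A binary operation $F$ on $X$ is weakly-increasing if, whenever $x\unlhd y$ and at least one of $x,y$ is transitive, $F(x,z)\unlhd F(y,z)$ for all $z\in X$. It is weakly-associative if $F(x,F(y,z))=F(F(x,y),z)$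 for all $x,y,z\in X$ such that at least one of $x,y,z$ is $\wedge$-associative or at least one of $x,y,z$ is $\vee$-associative. A pseudo-t-norm on $X$ is a commutative, weakly-increasing, weakly-associative binary operation $T$ with $T(1,x)=x$ for all $x\in X$. A t-norm on $X$ is a commutative, associative binary operation $T$ that is increasing ($x\unlhd y$ implies $T(x,z)\unlhd T(y,z)$ for all $z\in X$) and satisfies $T(1,x)=x$ for all $x\in X$. For binary operations $F_1,F_2$ on $X$, $F_1$ is $F_2$-distributive if $F_1(x,F_2(y,z))=F_2(F_1(x,y),F_1(x,z))$ for all $x,y,z\in X$ with $(y,z)\neq(0,0)$ and $(y,z)\neq(1,1)$. *)

theory Defs
  imports Main
begin

(* The underlying set X is the universe of the type 'a. *)

locale pseudo_order =
  fixes le :: "'a \<Rightarrow> 'a \<Rightarrow> bool"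
  assumes le_refl: "reflp le"
    and le_antisym: "antisymp le"

definition lower_bound :: "('a \<Rightarrow> 'a \<Rightarrow> bool) \<Rightarrow> 'a set \<Rightarrow> 'a \<Rightarrow> bool" where
  "lower_bound le A b \<longleftrightarrow> (\<forall>a\<in>A. le b a)"

definition upper_bound :: "('a \<Rightarrow> 'a \<Rightarrow> bool) \<Rightarrow> 'a set \<Rightarrow> 'a \<Rightarrow> bool" where
  "upper_bound le A b \<longleftrightarrow> (\<forall>a\<in>A. le a b)"

definition is_infimum :: "('a \<Rightarrow> 'a \<Rightarrow> bool) \<Rightarrow> 'a set \<Rightarrow> 'a \<Rightarrow> bool" where
  "is_infimum le A m \<longleftrightarrow> lower_bound le A m \<and> (\<forall>b. lower_bound le A b \<longrightarrow> le b m)"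

definition is_supremum :: "('a \<Rightarrow> 'a \<Rightarrow> bool) \<Rightarrow> 'a set \<Rightarrow> 'a \<Rightarrow> bool" where
  "is_supremum le A m \<longleftrightarrow> upper_bound le A m \<and> (\<forall>b. upper_bound le A b \<longrightarrow> le m b)"

(* By antisymmetry, meet and join are determined by le. *)
locale trellis = pseudo_order le
  for le :: "'a \<Rightarrow> 'a \<Rightarrow> bool" +
  fixes meet :: "'a \<Rightarrow> 'a \<Rightarrow> 'a"
    and join :: "'a \<Rightarrow> 'a \<Rightarrow> 'a"
  assumes meet_infimum: "is_infimum le {x, y} (meet x y)"
    and join_supremum: "is_supremum le {x, y} (join x y)"

locale bounded_trellis = trellis le meet join
  for le :: "'a \<Rightarrow> 'a \<Rightarrow> bool"
    and meet :: "'a \<Rightarrow> 'a \<Rightarrow> 'a"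
    and join :: "'a \<Rightarrow> 'a \<Rightarrow> 'a" +
  fixes zero :: 'a
    and one :: 'a
  assumes zero_least: "le zero x"
    and one_greatest: "le x one"

locale lattice_trellis = trellis le meet join
  for le :: "'a \<Rightarrow> 'a \<Rightarrow> bool"
    and meet :: "'a \<Rightarrow> 'a \<Rightarrow> 'a"
    and join :: "'a \<Rightarrow> 'a \<Rightarrow> 'a" +
  assumes le_trans: "transp le"

definition right_transitive :: "('a \<Rightarrow> 'a \<Rightarrow> bool) \<Rightarrow> 'a \<Rightarrow> bool" where
  "right_transitive le a \<longleftrightarrow> (\<forall>x y. le a x \<and> le x y \<longrightarrow> le a y)"

definition left_transitive :: "('a \<Rightarrow> 'a \<Rightarrow> bool) \<Rightarrow> 'a \<Rightarrow> bool" where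
  "left_transitive le a \<longleftrightarrow> (\<forall>x y. le x y \<and> le y a \<longrightarrow> le x a)"

definition middle_transitive :: "('a \<Rightarrow> 'a \<Rightarrow> bool) \<Rightarrow> 'a \<Rightarrow> bool" where
  "middle_transitive le a \<longleftrightarrow> (\<forall>x y. le x a \<and> le a y \<longrightarrow> le x y)"

definition transitive_element :: "('a \<Rightarrow> 'a \<Rightarrow> bool) \<Rightarrow> 'a \<Rightarrow> bool" where
  "transitive_element le a \<longleftrightarrow>
     right_transitive le a \<and> left_transitive le a \<and> middle_transitive le a"

(* Instantiating F with meet (join) gives meet-associative (join-associative)
   triples and elements. *)
definition associative_triple :: "('a \<Rightarrow> 'a \<Rightarrow> 'a) \<Rightarrow> 'a \<Rightarrow> 'a \<Rightarrow> 'a \<Rightarrow> bool" where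
  "associative_triple F x y z \<longleftrightarrow> F (F x y) z = F x (F y z)"

definition associative_element :: "('a \<Rightarrow> 'a \<Rightarrow> 'a) \<Rightarrow> 'a \<Rightarrow> bool" where
  "associative_element F a \<longleftrightarrow>
     (\<forall>x y z. a \<in> {x, y, z} \<longrightarrow> associative_triple F x y z)"

definition weakly_increasing ::
  "('a \<Rightarrow> 'a \<Rightarrow> bool) \<Rightarrow> ('a \<Rightarrow> 'a \<Rightarrow> 'a) \<Rightarrow> bool" where
  "weakly_increasing le F \<longleftrightarrow>
     (\<forall>x y. le x y \<and> (transitive_element le x \<or> transitive_element le y)
        \<longrightarrow> (\<forall>z. le (F x z) (F y z)))"

definition increasing ::
  "('a \<Rightarrow> 'a \<Rightarrow> bool) \<Rightarrow> ('a \<Rightarrow> 'a \<Rightarrow> 'a) \<Rightarrow> bool" where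
  "increasing le F \<longleftrightarrow> (\<forall>x y. le x y \<longrightarrow> (\<forall>z. le (F x z) (F y z)))"

definition weakly_associative ::
  "('a \<Rightarrow> 'a \<Rightarrow> 'a) \<Rightarrow> ('a \<Rightarrow> 'a \<Rightarrow> 'a) \<Rightarrow> ('a \<Rightarrow> 'a \<Rightarrow> 'a) \<Rightarrow> bool" where
  "weakly_associative meet join F \<longleftrightarrow>
     (\<forall>x y z.
        (\<exists>a\<in>{x, y, z}. associative_element meet a) \<or>
        (\<exists>a\<in>{x, y, z}. associative_element join a)
        \<longrightarrow> F x (F y z) = F (F x y) z)"

definition pseudo_t_norm ::
  "('a \<Rightarrow> 'a \<Rightarrow> bool) \<Rightarrow> ('a \<Rightarrow> 'a \<Rightarrow> 'a) \<Rightarrow> ('a \<Rightarrow> 'a \<Rightarrow> 'a) \<Rightarrow> 'a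
     \<Rightarrow> ('a \<Rightarrow> 'a \<Rightarrow> 'a) \<Rightarrow> bool" where
  "pseudo_t_norm le meet join one T \<longleftrightarrow>
     (\<forall>x y. T x y = T y x) \<and>
     weakly_increasing le T \<and>
     weakly_associative meet join T \<and>
     (\<forall>x. T one x = x)"

definition t_norm ::
  "('a \<Rightarrow> 'a \<Rightarrow> bool) \<Rightarrow> 'a \<Rightarrow> ('a \<Rightarrow> 'a \<Rightarrow> 'a) \<Rightarrow> bool" where
  "t_norm le one T \<longleftrightarrow>
     (\<forall>x y. T x y = T y x) \<and>
     (\<forall>x y z. T x (T y z) = T (T x y) z) \<and>
     increasing le T \<and>
     (\<forall>x. T one x = x)"

(* F1 is F2-distributive: the pairs (zero, zero) and (one, one) are exempt. *)
definition op_distributive ::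
  "'a \<Rightarrow> 'a \<Rightarrow> ('a \<Rightarrow> 'a \<Rightarrow> 'a) \<Rightarrow> ('a \<Rightarrow> 'a \<Rightarrow> 'a) \<Rightarrow> bool" where
  "op_distributive zero one F1 F2 \<longleftrightarrow>
     (\<forall>x y z. (y, z) \<noteq> (zero, zero) \<and> (y, z) \<noteq> (one, one)
        \<longrightarrow> F1 x (F2 y z) = F2 (F1 x y) (F1 x z))"

end

theory Submission
  imports Defs
begin

text \<open>
  The whole statement follows from idempotence of the t-norm \<open>T\<close> (written \<open>Tstar\<close> in the
  theorem). A t-norm always satisfies \<open>T x y \<unlhd> x\<close>, because it is increasing with unit \<open>one\<close>.
  If it is also idempotent, then \<open>x \<unlhd> y\<close> gives \<open>x = T x x \<unlhd> T y x \<unlhd> x\<close>, so that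
  \<open>x \<unlhd> y\<close> holds exactly when \<open>T x y = x\<close>. The pseudo-order is then the order of the
  semilattice \<open>(X, T)\<close>. Therefore it is transitive, and \<open>T\<close> is its infimum.

  To get \<open>T c c = c\<close> for a given \<open>c \<noteq> one\<close>, distributivity is applied to one pseudo-t-norm that
  has \<open>c\<close> as an idempotent. The meet is not a convenient choice, since its weak associativity at
  join-associative elements is not evident. The operation \<open>step_norm\<close> below serves instead: below
  the unit it takes only the values \<open>c\<close> and \<open>zero\<close>, which makes it associative on all
  triples. Distributing it over \<open>T one c = c\<close> with first argument \<open>c\<close> gives \<open>c = T c c\<close>.
\<close>

text \<open>
  For \<open>c = zero\<close> this is the drastic product, the least t-norm. Other values of \<open>c\<close> raise it
  just enough to make \<open>c\<close> idempotent.
\<close>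
definition step_norm :: "('a \<Rightarrow> 'a \<Rightarrow> bool) \<Rightarrow> 'a \<Rightarrow> 'a \<Rightarrow> 'a \<Rightarrow> 'a \<Rightarrow> 'a \<Rightarrow> 'a" where
  "step_norm le zero one c u v =
     (if u = one then v
      else if v = one then u
      else if le c u \<and> le c v then c
      else zero)"

context bounded_trellis
begin

lemma antisym: "le x y \<Longrightarrow> le y x \<Longrightarrow> x = y"
  using le_antisym by (auto dest: antisympD)

lemma refl: "le x x"
  using le_refl by (rule reflpD)

lemma le_zero_iff: "le c zero \<longleftrightarrow> c = zero"
  using antisym zero_least refl by blast

lemma one_le_iff: "le one x \<longleftrightarrow> x = one"
  using antisym one_greatest refl by blast

lemma step_norm_assoc:
  assumes "c \<noteq> one"
  shows "step_norm le zero one c x (step_norm le zero one c y z) =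
         step_norm le zero one c (step_norm le zero one c x y) z"
proof -
  have "zero \<noteq> one"
    using assms one_le_iff zero_least by metis
  then show ?thesis
    using assms refl by (auto simp: step_norm_def le_zero_iff)
qed

text \<open>
  Monotonicity needs the elements above \<open>c\<close> to be closed upwards: \<open>c \<unlhd> x \<unlhd> y\<close> must
  imply \<open>c \<unlhd> y\<close>. This is middle-transitivity of \<open>x\<close> or left-transitivity of \<open>y\<close>, and
  weak monotonicity only asks for pairs in which one of the two is available.
\<close>
lemma step_norm_weakly_increasing: "weakly_increasing le (step_norm le zero one c)"
  unfolding weakly_increasing_def
proof (intro allI impI)
  fix x y z
  assume xy: "le x y \<and> (transitive_element le x \<or> transitive_element le y)"
  have up: "le c y" if "le c x"
    using xy that
    unfolding transitive_element_def middle_transitive_def left_transitive_def by blast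
  show "le (step_norm le zero one c x z) (step_norm le zero one c y z)"
    using xy up refl zero_least by (auto simp: step_norm_def one_le_iff)
qed

lemma step_norm_pseudo_t_norm:
  assumes "c \<noteq> one"
  shows "pseudo_t_norm le meet join one (step_norm le zero one c)"
proof -
  have "step_norm le zero one c x y = step_norm le zero one c y x" for x y
    by (auto simp: step_norm_def)
  moreover have "step_norm le zero one c one x = x" for x
    by (simp add: step_norm_def)
  ultimately show ?thesis
    using step_norm_weakly_increasing step_norm_assoc[OF assms]
    unfolding pseudo_t_norm_def weakly_associative_def by blast
qed

lemma distributive_imp_idempotent:
  assumes unit: "\<And>x. T one x = x"
    and dist: "\<And>S. pseudo_t_norm le meet join one S \<Longrightarrow> op_distributive zero one S T"
  shows "T c c = c"
proof (cases "c = one")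
  case True
  then show ?thesis by (simp add: unit)
next
  case False
  let ?S = "step_norm le zero one c"
  have "op_distributive zero one ?S T"
    by (rule dist[OF step_norm_pseudo_t_norm[OF False]])
  \<comment> \<open>The pair \<open>(one, c)\<close> is not exempt from distributivity: either exemption would force
     \<open>c = one\<close>.\<close>
  moreover have "(one, c) \<noteq> (zero, zero)" "(one, c) \<noteq> (one, one)"
    using False by auto
  ultimately have "?S c (T one c) = T (?S c one) (?S c c)"
    unfolding op_distributive_def by blast
  moreover have "?S c one = c" "?S c c = c"
    using False refl by (simp_all add: step_norm_def)
  ultimately show ?thesis by (simp add: unit)
qed

lemma t_norm_le_left:
  assumes "t_norm le one T"
  shows "le (T x y) x"
proof -
  have "le (T y x) (T one x)"
    using assms one_greatest unfolding t_norm_def increasing_def by blast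
  then show ?thesis
    using assms unfolding t_norm_def by metis
qed

lemma idempotent_t_norm_le_iff:
  assumes T: "t_norm le one T" and idem: "\<And>x. T x x = x"
  shows "le x y \<longleftrightarrow> T x y = x"
proof
  have comm: "T u v = T v u" for u v
    using T unfolding t_norm_def by blast
  show "T x y = x" if "le x y"
  proof (rule antisym)
    show "le (T x y) x" by (rule t_norm_le_left[OF T])
    have "le (T x x) (T y x)"
      using T that unfolding t_norm_def increasing_def by blast
    then show "le x (T x y)" using idem comm by metis
  qed
  show "le x y" if "T x y = x"
    using t_norm_le_left[OF T, of y x] that comm by metis
qed

lemma idempotent_t_norm_lattice:
  assumes T: "t_norm le one T" and idem: "\<And>x. T x x = x"
  shows "T = meet \<and> lattice_trellis le meet join"
proof
  note le_iff = idempotent_t_norm_le_iff[OF assms]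
  have comm: "T x y = T y x" and assoc: "T x (T y z) = T (T x y) z" for x y z
    using T unfolding t_norm_def by blast+
  have "transp le"
    by (rule transpI) (metis le_iff assoc)
  then show "lattice_trellis le meet join"
    by unfold_locales
  show "T = meet"
  proof (intro ext antisym)
    fix x y
    have lower: "le (T x y) x" "le (T x y) y"
      using t_norm_le_left[OF T] comm by metis+
    then show "le (T x y) (meet x y)"
      using meet_infimum[of x y] unfolding is_infimum_def lower_bound_def by blast
    have "le (meet x y) x" "le (meet x y) y"
      using meet_infimum[of x y] unfolding is_infimum_def lower_bound_def by blast+
    then show "le (meet x y) (T x y)"
      by (metis le_iff assoc)
  qed
qed

end

theorem proposition5p4:
  fixes le :: "'a \<Rightarrow> 'a \<Rightarrow> bool"
    and meet join :: "'a \<Rightarrow> 'a \<Rightarrow> 'a"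
    and zero one :: 'a
    and Tstar :: "'a \<Rightarrow> 'a \<Rightarrow> 'a"
  assumes "bounded_trellis le meet join zero one"
    and "t_norm le one Tstar"
    and "\<forall>T. pseudo_t_norm le meet join one T \<longrightarrow> op_distributive zero one T Tstar"
  shows "Tstar = meet \<and> lattice_trellis le meet join"
proof -
  interpret bounded_trellis le meet join zero one by fact
  have "Tstar one x = x" for x
    using assms(2) unfolding t_norm_def by blast
  then have "Tstar c c = c" for c
    using distributive_imp_idempotent assms(3) by blast
  then show ?thesis
    by (rule idempotent_t_norm_lattice[OF assms(2)])
qed

end
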